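(* Let $X, Y$ be Banach spaces, $D_F \subseteq X$ open, $F : D_F \to Y$ a continuously Fréchet-differentiable operator, and $B \in L(Y,X)$ an invertible bounded linear operator. Let $x_0 \in D_F$, $R > 0$ with $\bar B(x_0,R) \subset D_F$, and let $\alpha \in (0,1]$, $l_0 > 0$, $\eta > 0$, $0 \le \nu < 1$ be constants such that $$\|B(F'(x) - F'(x_0))\| \le l_0 \|x - x_0\|^{\alpha} \quad \text{for all } x \in \bar B(x_0,R), \qquad \|BF'(x_0) - I\| \le \nu, \qquad \|BF(x_0)\| \le \eta .$$ Let $$g(\upsilon) = \frac{l_0}{1+\alpha}\,\upsilon^{\alpha+1} - (1-\nu)\,\upsilon + \eta, \quad \upsilon \ge 0,$$ and let $\eta_{\max} > 0$ be defined by $l_0\,\eta_{\max}^{\alpha} = (1-\nu)^{\alpha+1}\left[\frac{\alpha}{1+\alpha}\right]^{\alpha}$. Then: (1) The equation $g(\upsilon) = 0$ has a solution $\upsilon > 0$ if and only if $$l_0\,\eta^{\alpha} \le (1-\nu)^{\alpha+1}\left[\frac{\alpha}{1+\alpha}\right]^{\alpha},$$ and in that case its minimal solution $\upsilon_*$ satisfies $0 < \upsilon_* \le [(1-\nu)/l_0]^{1/\alpha}$. (2) Suppose the inequality in (1) holds, let $\upsilon_* \le \upsilon_{**}$ be the minimal and the maximal positive solutions of $g(\upsilon) = 0$ (with $\upsilon_{**} = \upsilon_*$ if $\eta = \eta_{\max}$), and suppose $R \ge \upsilon_*$. Then the sequence $x_{k+1} = x_k - BF(x_k)$, $k \ge 0$,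 started at $x_0$, is well-defined and converges to a solution $x_*$ of $BF(x) = 0$. The solution $x_*$ is unique in $B(x_0,\upsilon_{**}) \cap \bar B(x_0,R)$ if $\eta < \eta_{\max}$, and unique in $\bar B(x_0,\upsilon_{**}) \cap \bar B(x_0,R)$ if $\eta = \eta_{\max}$.
   Context: $B(x_0,r)$ and $\bar B(x_0,r)$ denote the open and closed balls in $X$ with center $x_0$ and radius $r$ (not to be confused with the operator $B$). $L(Y,X)$ is the space of bounded linear operators from $Y$ to $X$ with the operator norm, and $I$ is the identity operator on $X$. $F'(x)$ is the Fréchet derivative of $F$ at $x$; "continuously Fréchet-differentiable" means that $F$ is Fréchet-differentiable on $D_F$ and $x \mapsto F'(x)$ is continuous in operator norm. *)

theory Defs
  imports "HOL-Analysis.Analysis"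
begin

definition blinfun_invertible ::
    "('a::real_normed_vector \<Rightarrow>\<^sub>L 'b::real_normed_vector) \<Rightarrow> bool" where
  "blinfun_invertible B \<longleftrightarrow>
     (\<exists>C :: 'b \<Rightarrow>\<^sub>L 'a. B o\<^sub>L C = id_blinfun \<and> C o\<^sub>L B = id_blinfun)"

definition majorant :: "real \<Rightarrow> real \<Rightarrow> real \<Rightarrow> real \<Rightarrow> real \<Rightarrow> real" where
  "majorant l0 \<alpha> \<nu> \<eta> v = l0 / (1 + \<alpha>) * v powr (\<alpha> + 1) - (1 - \<nu>) * v + \<eta>"

definition minimal_positive_zero :: "(real \<Rightarrow> real) \<Rightarrow> real \<Rightarrow> bool" where
  "minimal_positive_zero g v \<longleftrightarrow> v > 0 \<and> g v = 0 \<and> (\<forall>u>0. g u = 0 \<longrightarrow> v \<le> u)"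

definition maximal_positive_zero :: "(real \<Rightarrow> real) \<Rightarrow> real \<Rightarrow> bool" where
  "maximal_positive_zero g v \<longleftrightarrow> v > 0 \<and> g v = 0 \<and> (\<forall>u>0. g u = 0 \<longrightarrow> u \<le> v)"

text \<open>
  \<open>F\<close> is a total function that represents an operator on its domain \<open>D\<close> only. The iteration
  from \<open>x0\<close> is well-defined for that operator iff all terms below lie in \<open>D\<close>; in that case
  they do not depend on the values of \<open>F\<close> outside \<open>D\<close>.
\<close>

primrec newton_like_iter ::
    "('b::real_normed_vector \<Rightarrow>\<^sub>L 'a::real_normed_vector) \<Rightarrow> ('a \<Rightarrow> 'b) \<Rightarrow> 'a \<Rightarrow> nat \<Rightarrow> 'a" where
  "newton_like_iter B F x0 0 = x0"
| "newton_like_iter B F x0 (Suc k) =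
     newton_like_iter B F x0 k - blinfun_apply B (F (newton_like_iter B F x0 k))"

definition unique_zero_in :: "('a \<Rightarrow> 'b::zero) \<Rightarrow> 'a set \<Rightarrow> 'a \<Rightarrow> bool" where
  "unique_zero_in G S z \<longleftrightarrow> z \<in> S \<and> G z = 0 \<and> (\<forall>y\<in>S. G y = 0 \<longrightarrow> y = z)"

end

theory Submission
  imports Defs
begin

text \<open>
  The iteration is \<open>x \<mapsto> T x\<close> with \<open>T x = x - B (F x)\<close>, and it is controlled by the scalar
  iteration \<open>t \<mapsto> h t\<close> with \<open>h t = t + g t\<close>, where \<open>g\<close> is the scalar majorant. The link is
  that \<open>h' t = \<nu> + l0 * t powr \<alpha>\<close> is exactly the bound that the hypotheses give for
  \<open>norm (T' x)\<close> at distance \<open>t\<close> from \<open>x0\<close>. Integrating along a segment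
  (\<open>newton_like_map_majorized\<close>), \<open>T\<close> moves two points apart by at most \<open>h t - h s\<close> whenever the
  first is within \<open>s\<close> of \<open>x0\<close> and the second within \<open>t - s\<close> of the first.

  From this bound alone Kantorovich's majorant principle follows (locale
  \<open>majorized_iteration\<close>). The sequence \<open>t k = (h ^^ k) 0\<close> increases to the least fixed point
  \<open>vs\<close> of \<open>h\<close>, and successive iterates of \<open>T\<close> are at distance at most \<open>t (k + 1) - t k\<close>;
  so they form a Cauchy sequence whose limit is a fixed point of \<open>T\<close>
  (\<open>iterate_tendsto_fixpoint\<close>). For uniqueness, a fixed point \<open>y\<close> of \<open>T\<close> within \<open>r\<close> of \<open>x0\<close>
  is compared with the scalar sequence \<open>s k = (h ^^ k) r\<close> started from above: the \<open>k\<close>-th iterate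
  is within \<open>s k - t k\<close> of \<open>y\<close>, and if \<open>h\<close> has no fixed point in \<open>(vs, r]\<close> and \<open>h r \<le> r\<close>,
  then \<open>s k\<close> also converges to \<open>vs\<close> (\<open>fixpoint_is_limit\<close>).

  It remains to locate the fixed points of \<open>h\<close>, that is, the zeros of \<open>g\<close>. The function \<open>g\<close>
  decreases strictly from \<open>\<eta>\<close> down to a minimum at \<open>((1 - \<nu>) / l0) powr (1 / \<alpha>)\<close> and increases
  strictly afterwards, and its minimum value is \<open>\<eta> - \<eta>max\<close>. Hence there are two zeros, one or
  none according as \<open>\<eta> < \<eta>max\<close>, \<open>\<eta> = \<eta>max\<close> or \<open>\<eta> > \<eta>max\<close> (\<open>majorant_zeros\<close>, \<open>majorant_ge\<close>).
\<close>

section \<open>The zeros of the scalar majorant\<close>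

text \<open>The point where the derivative \<open>l0 * v powr \<alpha> - (1 - \<nu>)\<close> of the majorant vanishes.\<close>
definition turning_point :: "real \<Rightarrow> real \<Rightarrow> real \<Rightarrow> real" where
  "turning_point l0 \<alpha> \<nu> = ((1 - \<nu>) / l0) powr (1 / \<alpha>)"

text \<open>
  The amount by which the majorant drops between \<open>0\<close> and its turning point, which does not
  depend on \<open>\<eta>\<close>. It is the closed form of the number \<open>\<eta>max\<close> that the theorem describes by an
  equation.
\<close>
definition critical_eta :: "real \<Rightarrow> real \<Rightarrow> real \<Rightarrow> real" where
  "critical_eta l0 \<alpha> \<nu> = \<alpha> / (1 + \<alpha>) * (1 - \<nu>) * turning_point l0 \<alpha> \<nu>"

lemma turning_point_pos:
  assumes "l0 > 0" "\<nu> < 1"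
  shows "turning_point l0 \<alpha> \<nu> > 0"
  using assms by (simp add: turning_point_def)

lemma turning_point_powr:
  assumes "0 < \<alpha>" "l0 > 0" "\<nu> < 1"
  shows "l0 * turning_point l0 \<alpha> \<nu> powr \<alpha> = 1 - \<nu>"
  using assms by (simp add: turning_point_def powr_powr)

lemma critical_eta_pos:
  assumes "0 < \<alpha>" "l0 > 0" "\<nu> < 1"
  shows "critical_eta l0 \<alpha> \<nu> > 0"
  using assms turning_point_pos[OF assms(2,3), of \<alpha>] by (simp add: critical_eta_def)

lemma critical_eta_powr:
  assumes "0 < \<alpha>" "l0 > 0" "\<nu> < 1"
  shows "l0 * critical_eta l0 \<alpha> \<nu> powr \<alpha> = (1 - \<nu>) powr (\<alpha> + 1) * (\<alpha> / (1 + \<alpha>)) powr \<alpha>"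
proof -
  have "l0 * critical_eta l0 \<alpha> \<nu> powr \<alpha> =
      (\<alpha> / (1 + \<alpha>)) powr \<alpha> * (1 - \<nu>) powr \<alpha> * (l0 * turning_point l0 \<alpha> \<nu> powr \<alpha>)"
    unfolding critical_eta_def
    using assms turning_point_pos[OF assms(2,3), of \<alpha>] by (simp add: powr_mult del: times_divide_eq_left)
  then show ?thesis
    using assms by (simp add: turning_point_powr powr_add mult_ac)
qed

lemma eta_condition_iff:
  assumes "0 < \<alpha>" "l0 > 0" "\<nu> < 1" "\<eta> > 0"
  shows "l0 * \<eta> powr \<alpha> \<le> (1 - \<nu>) powr (\<alpha> + 1) * (\<alpha> / (1 + \<alpha>)) powr \<alpha>
    \<longleftrightarrow> \<eta> \<le> critical_eta l0 \<alpha> \<nu>"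
proof -
  have "\<eta> powr \<alpha> \<le> critical_eta l0 \<alpha> \<nu> powr \<alpha> \<longleftrightarrow> \<eta> \<le> critical_eta l0 \<alpha> \<nu>"
    using assms critical_eta_pos[OF assms(1-3)]
    by (metis less_eq_real_def not_less powr_less_mono2 powr_mono2)
  then show ?thesis
    using assms critical_eta_powr[OF assms(1-3)] by (metis mult_le_cancel_left_pos)
qed

lemma eta_equation_imp_critical:
  assumes "0 < \<alpha>" "l0 > 0" "\<nu> < 1" "\<eta> > 0"
    and "l0 * \<eta> powr \<alpha> = (1 - \<nu>) powr (\<alpha> + 1) * (\<alpha> / (1 + \<alpha>)) powr \<alpha>"
  shows "\<eta> = critical_eta l0 \<alpha> \<nu>"
proof -
  have "l0 * \<eta> powr \<alpha> = l0 * critical_eta l0 \<alpha> \<nu> powr \<alpha>"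
    using assms critical_eta_powr[OF assms(1-3)] by simp
  then have "\<eta> powr \<alpha> = critical_eta l0 \<alpha> \<nu> powr \<alpha>"
    using assms(2) by simp
  then show ?thesis
    using assms critical_eta_pos[OF assms(1-3)]
    by (metis less_irrefl linorder_neqE_linordered_idom less_imp_le powr_less_mono2)
qed

lemma majorant_0: "majorant l0 \<alpha> \<nu> \<eta> 0 = \<eta>"
  by (simp add: majorant_def)

lemma majorant_factored:
  assumes "v > 0"
  shows "majorant l0 \<alpha> \<nu> \<eta> v = v * (l0 * v powr \<alpha> / (1 + \<alpha>) - (1 - \<nu>)) + \<eta>"
  using assms by (simp add: majorant_def powr_add algebra_simps)

lemma majorant_turning_point:
  assumes "0 < \<alpha>" "l0 > 0" "\<nu> < 1"
  shows "majorant l0 \<alpha> \<nu> \<eta> (turning_point l0 \<alpha> \<nu>) = \<eta> - critical_eta l0 \<alpha> \<nu>"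
  using assms
  by (simp add: majorant_factored turning_point_pos turning_point_powr critical_eta_def field_simps)

lemma majorant_has_derivative:
  assumes "0 < \<alpha>" "v > 0"
  shows "(majorant l0 \<alpha> \<nu> \<eta> has_real_derivative l0 * v powr \<alpha> - (1 - \<nu>)) (at v)"
proof -
  have "((\<lambda>v. v powr (\<alpha> + 1)) has_real_derivative (\<alpha> + 1) * v powr \<alpha>) (at v)"
    using has_real_derivative_powr[of v "\<alpha> + 1"] assms by simp
  then have "(majorant l0 \<alpha> \<nu> \<eta> has_real_derivative
      l0 / (1 + \<alpha>) * ((\<alpha> + 1) * v powr \<alpha>) - (1 - \<nu>) * 1 + 0) (at v)"
    unfolding majorant_def[abs_def]
    by (intro DERIV_add DERIV_diff DERIV_cmult DERIV_ident DERIV_const)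
  moreover have "l0 / (1 + \<alpha>) * ((\<alpha> + 1) * v powr \<alpha>) = l0 * v powr \<alpha>"
    using assms by (simp add: add.commute)
  ultimately show ?thesis by simp
qed

lemma continuous_on_majorant:
  assumes "0 < \<alpha>"
  shows "continuous_on {0..} (majorant l0 \<alpha> \<nu> \<eta>)"
  unfolding majorant_def[abs_def] using assms
  by (intro continuous_intros continuous_on_powr') auto

lemma majorant_decreasing:
  assumes "0 < \<alpha>" "l0 > 0" "\<nu> < 1" "0 \<le> u" "u < v" "v \<le> turning_point l0 \<alpha> \<nu>"
  shows "majorant l0 \<alpha> \<nu> \<eta> v < majorant l0 \<alpha> \<nu> \<eta> u"
proof (rule DERIV_neg_imp_decreasing_open[OF \<open>u < v\<close>])
  fix x assume x: "u < x" "x < v"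
  have "x powr \<alpha> < turning_point l0 \<alpha> \<nu> powr \<alpha>"
    using assms x by (intro powr_less_mono2) auto
  then have "l0 * x powr \<alpha> - (1 - \<nu>) < 0"
    using turning_point_powr[OF assms(1-3)] assms(2) by (metis diff_less_0_iff_less mult_less_cancel_left_pos)
  then show "\<exists>y. (majorant l0 \<alpha> \<nu> \<eta> has_real_derivative y) (at x) \<and> y < 0"
    using majorant_has_derivative[of \<alpha> x l0 \<nu> \<eta>] assms(1,4) x by fastforce
next
  show "continuous_on {u..v} (majorant l0 \<alpha> \<nu> \<eta>)"
    using continuous_on_majorant[OF assms(1)] by (rule continuous_on_subset) (use assms in auto)
qed

lemma majorant_increasing:
  assumes "0 < \<alpha>" "l0 > 0" "\<nu> < 1" "turning_point l0 \<alpha> \<nu> \<le> u" "u < v"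
  shows "majorant l0 \<alpha> \<nu> \<eta> u < majorant l0 \<alpha> \<nu> \<eta> v"
proof (rule DERIV_pos_imp_increasing_open[OF \<open>u < v\<close>])
  fix x assume x: "u < x" "x < v"
  have "turning_point l0 \<alpha> \<nu> powr \<alpha> < x powr \<alpha>"
    using assms x turning_point_pos[OF assms(2,3), of \<alpha>] by (intro powr_less_mono2) auto
  then have "l0 * x powr \<alpha> - (1 - \<nu>) > 0"
    using turning_point_powr[OF assms(1-3)] assms(2) by (metis diff_gt_0_iff_gt mult_less_cancel_left_pos)
  then show "\<exists>y. (majorant l0 \<alpha> \<nu> \<eta> has_real_derivative y) (at x) \<and> y > 0"
    using majorant_has_derivative[of \<alpha> x l0 \<nu> \<eta>] assms(1,4) x
      turning_point_pos[OF assms(2,3), of \<alpha>] by fastforce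
next
  show "continuous_on {u..v} (majorant l0 \<alpha> \<nu> \<eta>)"
    using continuous_on_majorant[OF assms(1)]
    by (rule continuous_on_subset) (use assms turning_point_pos[OF assms(2,3), of \<alpha>] in auto)
qed

text \<open>The lower bound is the value at the turning point; it makes the condition on \<open>\<eta>\<close> necessary.\<close>
lemma majorant_ge:
  assumes "0 < \<alpha>" "l0 > 0" "\<nu> < 1" "0 \<le> v"
  shows "\<eta> - critical_eta l0 \<alpha> \<nu> \<le> majorant l0 \<alpha> \<nu> \<eta> v"
  using majorant_decreasing[OF assms(1-4), of "turning_point l0 \<alpha> \<nu>" \<eta>]
    majorant_increasing[OF assms(1-3), of "turning_point l0 \<alpha> \<nu>" v \<eta>]
    majorant_turning_point[OF assms(1-3), of \<eta>]
  by (metis less_eq_real_def linorder_neqE_linordered_idom order_refl)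

text \<open>
  The majorant, which exceeds \<open>\<eta>\<close> by \<open>v * (l0 * v powr \<alpha> / (1 + \<alpha>) - (1 - \<nu>))\<close>, takes its
  initial value \<open>\<eta>\<close> again where the second factor vanishes. This provides the positive end for
  the intermediate value argument on the increasing branch.
\<close>
lemma majorant_returns:
  assumes "0 < \<alpha>" "l0 > 0" "\<nu> < 1"
  obtains w where "w > turning_point l0 \<alpha> \<nu>" "majorant l0 \<alpha> \<nu> \<eta> w = \<eta>"
proof
  define w where "w = ((1 - \<nu>) * (1 + \<alpha>) / l0) powr (1 / \<alpha>)"
  have "w powr \<alpha> = (1 - \<nu>) * (1 + \<alpha>) / l0"
    using assms by (simp add: w_def powr_powr)
  moreover have "w > 0"
    using assms by (simp add: w_def)
  ultimately show "majorant l0 \<alpha> \<nu> \<eta> w = \<eta>"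
    using assms by (simp add: majorant_factored)
  show "w > turning_point l0 \<alpha> \<nu>"
    unfolding w_def turning_point_def using assms
    by (intro powr_less_mono2) (auto simp: field_simps)
qed

text \<open>
  Each of the two monotone branches carries exactly one zero, and the two coincide exactly when
  the minimum value \<open>\<eta> - critical_eta l0 \<alpha> \<nu>\<close> is zero.
\<close>
lemma majorant_zeros:
  assumes "0 < \<alpha>" "l0 > 0" "\<nu> < 1" "\<eta> > 0" "\<eta> \<le> critical_eta l0 \<alpha> \<nu>"
  obtains vs vss where
    "0 < vs" "vs \<le> turning_point l0 \<alpha> \<nu>" "vs \<le> vss"
    "\<And>u. u \<ge> 0 \<Longrightarrow> majorant l0 \<alpha> \<nu> \<eta> u = 0 \<longleftrightarrow> u = vs \<or> u = vss"
    "\<And>u. vs \<le> u \<Longrightarrow> u \<le> vss \<Longrightarrow> majorant l0 \<alpha> \<nu> \<eta> u \<le> 0"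
    "vs = vss \<longleftrightarrow> \<eta> = critical_eta l0 \<alpha> \<nu>"
proof -
  let ?g = "majorant l0 \<alpha> \<nu> \<eta>" and ?m = "turning_point l0 \<alpha> \<nu>"
  note cont = continuous_on_subset[OF continuous_on_majorant[OF assms(1)]]
  note dec = majorant_decreasing[OF assms(1-3), of _ _ \<eta>]
  note inc = majorant_increasing[OF assms(1-3), of _ _ \<eta>]
  have m: "?m > 0" "?g ?m = \<eta> - critical_eta l0 \<alpha> \<nu>"
    using assms by (auto simp: turning_point_pos majorant_turning_point)
  have "\<exists>x\<ge>0. x \<le> ?m \<and> ?g x = 0"
    using m assms by (intro IVT2') (auto simp: majorant_0 intro!: cont)
  then obtain vs where vs: "0 \<le> vs" "vs \<le> ?m" "?g vs = 0"
    by blast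
  obtain w where w: "w > ?m" "?g w = \<eta>"
    using majorant_returns[OF assms(1-3)] by blast
  have "\<exists>x\<ge>?m. x \<le> w \<and> ?g x = 0"
    using m w assms by (intro IVT') (auto intro!: cont)
  then obtain vss where vss: "?m \<le> vss" "?g vss = 0"
    by blast
  have "vs \<noteq> 0"
    using vs assms majorant_0[of l0 \<alpha> \<nu> \<eta>] by auto
  moreover have "?g u = 0 \<longleftrightarrow> u = vs \<or> u = vss" if "u \<ge> 0" for u
    using dec[of u vs] dec[of vs u] inc[of u vss] inc[of vss u] vs vss that by fastforce
  moreover have "?g u \<le> 0" if "vs \<le> u" "u \<le> vss" for u
    using dec[of vs u] inc[of u vss] vs vss that
    by (cases "u \<le> ?m"; cases "u = vs"; cases "u = vss") auto
  moreover have "vs = vss \<longleftrightarrow> \<eta> = critical_eta l0 \<alpha> \<nu>"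
    using dec[of vs ?m] inc[of ?m vss] vs vss m by fastforce
  ultimately show ?thesis
    using that[of vs vss] vs vss by auto
qed

section \<open>The majorant principle for fixed-point iterations\<close>

text \<open>
  The assumption \<open>majorized\<close> is the integrated form of a bound on the derivative of \<open>T\<close> by that
  of \<open>h\<close>. It contains the monotonicity of \<open>h\<close> (take both points equal to \<open>x0\<close>), and enough
  continuity of \<open>T\<close> for the limit of the iterates to be a fixed point.
\<close>
locale majorized_iteration =
  fixes T :: "'a::banach \<Rightarrow> 'a" and h :: "real \<Rightarrow> real" and x0 :: 'a and R v :: real
  assumes start: "norm (T x0 - x0) \<le> h 0"
    and majorized: "\<And>s t x y. 0 \<le> s \<Longrightarrow> s \<le> t \<Longrightarrow> t \<le> R \<Longrightarrow> norm (x - x0) \<le> s \<Longrightarrow>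
      norm (y - x) \<le> t - s \<Longrightarrow> norm (T y - T x) \<le> h t - h s"
    and continuous: "continuous_on {0..R} h"
    and fixpoint: "0 \<le> v" "v \<le> R" "h v = v"
    and least: "\<And>u. 0 \<le> u \<Longrightarrow> u \<le> v \<Longrightarrow> h u = u \<Longrightarrow> u = v"
begin

lemma h_mono:
  assumes "0 \<le> s" "s \<le> t" "t \<le> R"
  shows "h s \<le> h t"
  using majorized[OF assms, of x0 x0] assms by simp

lemma h_0_nonneg: "0 \<le> h 0"
  using start norm_ge_zero order_trans by blast

lemma scalar_bounds: "0 \<le> (h ^^ k) 0 \<and> (h ^^ k) 0 \<le> (h ^^ Suc k) 0 \<and> (h ^^ k) 0 \<le> v"
proof (induction k)
  case 0
  then show ?case using fixpoint h_0_nonneg by simp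
next
  case (Suc k)
  then have "h ((h ^^ k) 0) \<le> h v"
    using fixpoint by (intro h_mono) auto
  with Suc have "0 \<le> (h ^^ Suc k) 0" "(h ^^ Suc k) 0 \<le> v"
    using fixpoint by auto
  moreover have "h ((h ^^ k) 0) \<le> h ((h ^^ Suc k) 0)"
    using Suc calculation fixpoint by (intro h_mono) auto
  ultimately show ?case by simp
qed

lemma limit_is_fixpoint:
  assumes lim: "(\<lambda>k. (h ^^ k) a) \<longlonglongrightarrow> l" and range: "\<And>k. (h ^^ k) a \<in> {0..R}"
  shows "l \<in> {0..R}" "h l = l"
proof -
  show l: "l \<in> {0..R}"
    using closed_atLeastAtMost range lim by (rule closed_sequentially)
  have "(\<lambda>k. h ((h ^^ k) a)) \<longlonglongrightarrow> h l"
    using continuous_on_tendsto_compose[OF continuous lim l] range by simp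
  moreover have "(\<lambda>k. h ((h ^^ k) a)) \<longlonglongrightarrow> l"
    using LIMSEQ_Suc[OF lim] by simp
  ultimately show "h l = l"
    by (rule LIMSEQ_unique)
qed

text \<open>The bounded increasing sequence tends to a fixed point in \<open>[0, v]\<close>, and \<open>v\<close> is the only one.\<close>
lemma scalar_tendsto: "(\<lambda>k. (h ^^ k) 0) \<longlonglongrightarrow> v"
proof -
  obtain l where l: "(\<lambda>k. (h ^^ k) 0) \<longlonglongrightarrow> l" "\<And>k. (h ^^ k) 0 \<le> l"
    using incseq_convergent[of "\<lambda>k. (h ^^ k) 0" v] scalar_bounds
    by (metis incseq_SucI)
  have range: "(h ^^ k) 0 \<in> {0..R}" for k
    using scalar_bounds[of k] fixpoint by auto
  have "l \<le> v"
    using l(1) scalar_bounds by (intro LIMSEQ_le_const2) auto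
  then have "l = v"
    using limit_is_fixpoint[OF l(1) range] least by auto
  then show ?thesis using l by simp
qed

text \<open>
  Both bounds go through one induction: at the step, they are the hypotheses of \<open>majorized\<close> for
  \<open>s = (h ^^ k) 0\<close> and \<open>t = (h ^^ Suc k) 0\<close>.
\<close>
lemma iterate_bounds:
  "norm ((T ^^ k) x0 - x0) \<le> (h ^^ k) 0
    \<and> norm ((T ^^ Suc k) x0 - (T ^^ k) x0) \<le> (h ^^ Suc k) 0 - (h ^^ k) 0"
proof (induction k)
  case 0
  then show ?case using start by simp
next
  case (Suc k)
  have "norm ((T ^^ Suc k) x0 - x0) \<le> (h ^^ Suc k) 0"
    using norm_triangle_ineq[of "(T ^^ Suc k) x0 - (T ^^ k) x0" "(T ^^ k) x0 - x0"] Suc by simp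
  moreover have "norm (T ((T ^^ Suc k) x0) - T ((T ^^ k) x0)) \<le> h ((h ^^ Suc k) 0) - h ((h ^^ k) 0)"
    using Suc scalar_bounds[of k] scalar_bounds[of "Suc k"] fixpoint by (intro majorized) auto
  ultimately show ?case by simp
qed

lemma iterate_in_cball: "(T ^^ k) x0 \<in> cball x0 v"
  using iterate_bounds[of k] scalar_bounds[of k] by (simp add: dist_norm norm_minus_commute)

lemma iterate_distance:
  assumes "k \<le> n"
  shows "norm ((T ^^ n) x0 - (T ^^ k) x0) \<le> (h ^^ n) 0 - (h ^^ k) 0"
  using assms
proof (induction n rule: dec_induct)
  case (step n)
  then show ?case
    using iterate_bounds[of n]
      norm_triangle_ineq[of "(T ^^ Suc n) x0 - (T ^^ n) x0" "(T ^^ n) x0 - (T ^^ k) x0"]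
    by simp
qed simp

text \<open>
  The error bound \<open>v - (h ^^ k) 0\<close> for the \<open>k\<close>-th iterate allows \<open>majorized\<close> to be applied to
  that iterate and the limit \<open>z\<close> themselves, with \<open>t = v\<close>; so \<open>T z\<close> is the limit of the
  iterates too.
\<close>
lemma iterate_tendsto_fixpoint:
  obtains z where "(\<lambda>k. (T ^^ k) x0) \<longlonglongrightarrow> z" "z \<in> cball x0 v" "T z = z"
proof -
  have "Cauchy (\<lambda>k. (T ^^ k) x0)"
  proof (rule CauchyI')
    fix e :: real assume "e > 0"
    then obtain M where M: "\<And>k. k \<ge> M \<Longrightarrow> dist ((h ^^ k) 0) v < e"
      using scalar_tendsto by (metis metric_LIMSEQ_D)
    have "dist ((T ^^ k) x0) ((T ^^ n) x0) < e" if "M \<le> k" "k < n" for k n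
      using M[OF that(1)] iterate_distance[of k n] that scalar_bounds[of n] scalar_bounds[of k]
      by (auto simp: dist_norm norm_minus_commute)
    then show "\<exists>M. \<forall>k\<ge>M. \<forall>n>k. dist ((T ^^ k) x0) ((T ^^ n) x0) < e"
      by blast
  qed
  then obtain z where z: "(\<lambda>k. (T ^^ k) x0) \<longlonglongrightarrow> z"
    using Cauchy_convergent convergent_def by blast
  have mem: "z \<in> cball x0 v"
    using closed_cball iterate_in_cball z by (rule closed_sequentially)
  have error: "norm (z - (T ^^ k) x0) \<le> v - (h ^^ k) 0" for k
  proof (rule LIMSEQ_le)
    show "(\<lambda>n. norm ((T ^^ n) x0 - (T ^^ k) x0)) \<longlonglongrightarrow> norm (z - (T ^^ k) x0)"
      by (intro tendsto_intros z)
    show "(\<lambda>n. (h ^^ n) 0 - (h ^^ k) 0) \<longlonglongrightarrow> v - (h ^^ k) 0"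
      by (intro tendsto_intros scalar_tendsto)
  qed (use iterate_distance in blast)
  have "norm (T z - (T ^^ Suc k) x0) \<le> v - (h ^^ Suc k) 0" for k
    using majorized[of "(h ^^ k) 0" v "(T ^^ k) x0" z] scalar_bounds[of k] iterate_bounds[of k]
      error[of k] fixpoint by simp
  moreover have "(\<lambda>k. v - (h ^^ Suc k) 0) \<longlonglongrightarrow> 0"
    using tendsto_diff[OF tendsto_const LIMSEQ_Suc[OF scalar_tendsto], of v] by simp
  ultimately have "(\<lambda>k. T z - (T ^^ Suc k) x0) \<longlonglongrightarrow> 0"
    by (rule Lim_null_comparison[OF always_eventually[OF allI]])
  moreover have "(\<lambda>k. T z - (T ^^ Suc k) x0) \<longlonglongrightarrow> T z - z"
    by (intro tendsto_intros LIMSEQ_Suc[OF z])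
  ultimately have "T z - z = 0"
    using LIMSEQ_unique by blast
  then show ?thesis
    using that z mem by simp
qed

text \<open>
  The scalar sequence started at \<open>r\<close> decreases to \<open>v\<close>, while the one started at \<open>0\<close> increases
  to \<open>v\<close>; the gap between them bounds the distance from the \<open>k\<close>-th iterate to \<open>y\<close>, because
  \<open>majorized\<close> sends the bound for \<open>k\<close> to the bound for \<open>k + 1\<close>.
\<close>
lemma fixpoint_is_limit:
  assumes r: "v \<le> r" "r \<le> R" "h r \<le> r"
    and only: "\<And>u. v \<le> u \<Longrightarrow> u \<le> r \<Longrightarrow> h u = u \<Longrightarrow> u = v"
    and y: "y \<in> cball x0 r" "T y = y"
  shows "(\<lambda>k. (T ^^ k) x0) \<longlonglongrightarrow> y"
proof -
  have upper: "v \<le> (h ^^ k) r \<and> (h ^^ Suc k) r \<le> (h ^^ k) r \<and> (h ^^ k) r \<le> r" for k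
  proof (induction k)
    case 0
    then show ?case using r by simp
  next
    case (Suc k)
    then have "h v \<le> h ((h ^^ k) r)"
      using fixpoint r by (intro h_mono) auto
    then have lower: "v \<le> (h ^^ Suc k) r"
      using fixpoint by simp
    then have "h ((h ^^ Suc k) r) \<le> h ((h ^^ k) r)"
      using fixpoint Suc r by (intro h_mono) auto
    then show ?case using lower Suc by simp
  qed
  obtain l where l: "(\<lambda>k. (h ^^ k) r) \<longlonglongrightarrow> l" "\<And>k. l \<le> (h ^^ k) r"
    using decseq_convergent[of "\<lambda>k. (h ^^ k) r" v] upper by (metis decseq_SucI)
  have range: "(h ^^ k) r \<in> {0..R}" for k
    using upper[of k] fixpoint r by auto
  have "v \<le> l"
    using l(1) upper by (intro LIMSEQ_le_const) auto
  moreover have "l \<le> r"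
    using l(2)[of 0] by simp
  ultimately have "l = v"
    using limit_is_fixpoint[OF l(1) range] only by blast
  have dist: "norm (y - (T ^^ k) x0) \<le> (h ^^ k) r - (h ^^ k) 0" for k
  proof (induction k)
    case 0
    then show ?case using y by (simp add: dist_norm norm_minus_commute)
  next
    case (Suc k)
    have "norm (T y - T ((T ^^ k) x0)) \<le> h ((h ^^ k) r) - h ((h ^^ k) 0)"
      using Suc scalar_bounds[of k] upper[of k] iterate_bounds[of k] r by (intro majorized) auto
    then show ?case using y by simp
  qed
  have "(\<lambda>k. (h ^^ k) r - (h ^^ k) 0) \<longlonglongrightarrow> 0"
    using tendsto_diff[OF l(1) scalar_tendsto] \<open>l = v\<close> by simp
  then have "(\<lambda>k. y - (T ^^ k) x0) \<longlonglongrightarrow> 0"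
    by (rule Lim_null_comparison[OF always_eventually[OF allI[OF dist]]])
  then have "(\<lambda>k. y - (y - (T ^^ k) x0)) \<longlonglongrightarrow> y - 0"
    by (intro tendsto_diff tendsto_const)
  then show ?thesis by simp
qed

end

section \<open>The majorant bound for the Newton-like map\<close>

lemma newton_like_iter_eq_funpow:
  "newton_like_iter B F x0 k = ((\<lambda>x. x - blinfun_apply B (F x)) ^^ k) x0"
  by (induction k) simp_all

lemma newton_like_map_derivative_bound:
  fixes B :: "'b::real_normed_vector \<Rightarrow>\<^sub>L 'a::real_normed_vector"
  assumes "norm (B o\<^sub>L (A - A0)) \<le> c" "norm ((B o\<^sub>L A0) - id_blinfun) \<le> \<nu>"
  shows "norm (id_blinfun - (B o\<^sub>L A)) \<le> \<nu> + c"
proof -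
  have "id_blinfun - (B o\<^sub>L A) = - (((B o\<^sub>L A0) - id_blinfun) + (B o\<^sub>L (A - A0)))"
    by (rule blinfun_eqI) (simp add: blinfun.bilinear_simps)
  also have "norm \<dots> \<le> norm ((B o\<^sub>L A0) - id_blinfun) + norm (B o\<^sub>L (A - A0))"
    unfolding norm_minus_cancel by (rule norm_triangle_ineq)
  finally show ?thesis using assms by linarith
qed

text \<open>
  The point at parameter \<open>\<tau>\<close> on the segment from \<open>x\<close> to \<open>y\<close> is within \<open>q \<tau> = s + \<tau> * (t - s)\<close>
  of \<open>x0\<close>. So the speed of the image curve \<open>T (p \<tau>)\<close> is at most that of the scalar curve
  \<open>h (q \<tau>)\<close>, and the mean value inequality compares their increments. The case \<open>s = t\<close> is
  split off so that \<open>q \<tau> > 0\<close> for \<open>\<tau> > 0\<close>, where \<open>h\<close> is differentiable by \<open>majorant_has_derivative\<close>.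
\<close>
lemma newton_like_map_majorized:
  fixes F :: "'a::real_normed_vector \<Rightarrow> 'b::real_normed_vector"
    and F' :: "'a \<Rightarrow> ('a \<Rightarrow>\<^sub>L 'b)" and B :: "'b \<Rightarrow>\<^sub>L 'a"
  assumes deriv: "\<And>x. x \<in> cball x0 R \<Longrightarrow> (F has_derivative blinfun_apply (F' x)) (at x)"
    and "0 < \<alpha>" "l0 \<ge> 0"
    and hoelder: "\<And>x. x \<in> cball x0 R \<Longrightarrow> norm (B o\<^sub>L (F' x - F' x0)) \<le> l0 * norm (x - x0) powr \<alpha>"
    and near_id: "norm ((B o\<^sub>L F' x0) - id_blinfun) \<le> \<nu>"
    and s: "0 \<le> s" "s \<le> t" "t \<le> R" and x: "norm (x - x0) \<le> s" and y: "norm (y - x) \<le> t - s"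
  shows "norm ((y - blinfun_apply B (F y)) - (x - blinfun_apply B (F x)))
    \<le> (t + majorant l0 \<alpha> \<nu> \<eta> t) - (s + majorant l0 \<alpha> \<nu> \<eta> s)"
proof (cases "s = t")
  case True
  then show ?thesis using y by simp
next
  case False
  with s have "s < t" by simp
  define T where "T = (\<lambda>x. x - blinfun_apply B (F x))"
  define p where "p = (\<lambda>\<tau>. x + \<tau> *\<^sub>R (y - x))"
  define q where "q = (\<lambda>\<tau>. s + \<tau> * (t - s))"
  define h where "h = (\<lambda>v. v + majorant l0 \<alpha> \<nu> \<eta> v)"
  have p: "norm (p \<tau> - x0) \<le> q \<tau>" if "0 \<le> \<tau>" for \<tau>
  proof -
    have "norm (p \<tau> - x0) \<le> norm (x - x0) + \<tau> * norm (y - x)"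
      using norm_triangle_ineq[of "x - x0" "\<tau> *\<^sub>R (y - x)"] that
      by (simp add: p_def add_diff_eq diff_add_eq)
    also have "\<dots> \<le> q \<tau>"
      unfolding q_def using x mult_left_mono[OF y that] by simp
    finally show ?thesis .
  qed
  have q: "0 \<le> q \<tau>" "q \<tau> \<le> R" if "0 \<le> \<tau>" "\<tau> \<le> 1" for \<tau>
    using s that mult_right_mono[of \<tau> 1 "t - s"] by (auto simp: q_def)
  have mem: "p \<tau> \<in> cball x0 R" if "0 \<le> \<tau>" "\<tau> \<le> 1" for \<tau>
    using p[OF that(1)] q(2)[OF that] by (simp add: dist_norm norm_minus_commute)
  have dT: "((\<lambda>\<tau>. T (p \<tau>)) has_vector_derivative
      blinfun_apply (id_blinfun - (B o\<^sub>L F' (p \<tau>))) (y - x)) (at \<tau>)" if "0 \<le> \<tau>" "\<tau> \<le> 1" for \<tau>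
  proof -
    have "(T has_derivative (\<lambda>d. d - blinfun_apply B (blinfun_apply (F' (p \<tau>)) d))) (at (p \<tau>))"
      unfolding T_def
      by (intro has_derivative_diff has_derivative_ident
          bounded_linear.has_derivative[OF blinfun.bounded_linear_right] deriv mem that)
    moreover have "(p has_vector_derivative (y - x)) (at \<tau>)"
      unfolding p_def by (auto intro!: derivative_eq_intros)
    ultimately show ?thesis
      using vector_derivative_diff_chain_within[of p "y - x" \<tau> UNIV T]
      by (auto simp: o_def blinfun.diff_left intro: has_derivative_at_withinI)
  qed
  have dh: "((\<lambda>\<tau>. h (q \<tau>)) has_vector_derivative (\<nu> + l0 * q \<tau> powr \<alpha>) * (t - s)) (at \<tau>)"
    if "0 < \<tau>" for \<tau>
  proof -
    have "q \<tau> > 0"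
      using s \<open>s < t\<close> that by (simp add: q_def add_nonneg_pos)
    then have "(h has_real_derivative \<nu> + l0 * q \<tau> powr \<alpha>) (at (q \<tau>))"
      unfolding h_def using assms(2)
      by (auto intro!: derivative_eq_intros majorant_has_derivative)
    moreover have "(q has_real_derivative (t - s)) (at \<tau>)"
      unfolding q_def by (auto intro!: derivative_eq_intros)
    ultimately show ?thesis
      unfolding has_real_derivative_iff_has_vector_derivative[symmetric] by (rule DERIV_chain2)
  qed
  have "norm (T (p 1) - T (p 0)) \<le> h (q 1) - h (q 0)"
  proof (rule differentiable_bound_general[where f = "\<lambda>\<tau>. T (p \<tau>)" and \<phi> = "\<lambda>\<tau>. h (q \<tau>)"])
    show "continuous_on {0..1} (\<lambda>\<tau>. T (p \<tau>))"
      using has_vector_derivative_continuous[OF dT]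
      by (intro continuous_at_imp_continuous_on) auto
    have "continuous_on {0..} h"
      unfolding h_def by (intro continuous_intros continuous_on_majorant assms(2))
    moreover have "continuous_on {0..1} q"
      unfolding q_def by (intro continuous_intros)
    ultimately show "continuous_on {0..1} (\<lambda>\<tau>. h (q \<tau>))"
      by (rule continuous_on_compose2) (use q in auto)
    fix \<tau> :: real assume \<tau>: "0 < \<tau>" "\<tau> < 1"
    show "((\<lambda>\<tau>. T (p \<tau>)) has_vector_derivative
        blinfun_apply (id_blinfun - (B o\<^sub>L F' (p \<tau>))) (y - x)) (at \<tau>)"
      using dT \<tau> by simp
    show "((\<lambda>\<tau>. h (q \<tau>)) has_vector_derivative (\<nu> + l0 * q \<tau> powr \<alpha>) * (t - s)) (at \<tau>)"
      using dh \<tau> by simp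
    have "norm (B o\<^sub>L (F' (p \<tau>) - F' x0)) \<le> l0 * q \<tau> powr \<alpha>"
      using hoelder[OF mem[of \<tau>]] p[of \<tau>] \<tau> assms(2,3)
      by (meson less_imp_le mult_left_mono norm_ge_zero order_trans powr_mono2)
    then have "norm (id_blinfun - (B o\<^sub>L F' (p \<tau>))) \<le> \<nu> + l0 * q \<tau> powr \<alpha>"
      using near_id by (rule newton_like_map_derivative_bound)
    then show "norm (blinfun_apply (id_blinfun - (B o\<^sub>L F' (p \<tau>))) (y - x))
        \<le> (\<nu> + l0 * q \<tau> powr \<alpha>) * (t - s)"
      using y norm_blinfun[of "id_blinfun - (B o\<^sub>L F' (p \<tau>))" "y - x"]
      by (meson mult_mono norm_ge_zero order_trans)
  qed simp
  then show ?thesis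
    by (simp add: T_def p_def q_def h_def)
qed

section \<open>The semilocal convergence theorem\<close>

theorem mainTheorem2:
  fixes D :: "'a::banach set"
    and F :: "'a \<Rightarrow> 'b::banach"
    and F' :: "'a \<Rightarrow> ('a \<Rightarrow>\<^sub>L 'b)"
    and B :: "'b \<Rightarrow>\<^sub>L 'a"
    and x0 :: 'a
    and R \<alpha> l0 \<eta> \<nu> \<eta>max :: real
  assumes "open D"
    and "\<And>x. x \<in> D \<Longrightarrow> (F has_derivative blinfun_apply (F' x)) (at x)"
    and "continuous_on D F'"
    and "blinfun_invertible B"
    and "x0 \<in> D" and "R > 0" and "cball x0 R \<subseteq> D"
    and "0 < \<alpha>" and "\<alpha> \<le> 1" and "l0 > 0" and "\<eta> > 0" and "0 \<le> \<nu>" and "\<nu> < 1"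
    and "\<And>x. x \<in> cball x0 R \<Longrightarrow> norm (B o\<^sub>L (F' x - F' x0)) \<le> l0 * norm (x - x0) powr \<alpha>"
    and "norm ((B o\<^sub>L F' x0) - id_blinfun) \<le> \<nu>"
    and "norm (blinfun_apply B (F x0)) \<le> \<eta>"
    and "\<eta>max > 0"
    and "l0 * \<eta>max powr \<alpha> = (1 - \<nu>) powr (\<alpha> + 1) * (\<alpha> / (1 + \<alpha>)) powr \<alpha>"
  shows
    "((\<exists>v>0. majorant l0 \<alpha> \<nu> \<eta> v = 0) \<longleftrightarrow>
        l0 * \<eta> powr \<alpha> \<le> (1 - \<nu>) powr (\<alpha> + 1) * (\<alpha> / (1 + \<alpha>)) powr \<alpha>)
     \<and> (l0 * \<eta> powr \<alpha> \<le> (1 - \<nu>) powr (\<alpha> + 1) * (\<alpha> / (1 + \<alpha>)) powr \<alpha> \<longrightarrow>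
          (\<exists>vs. minimal_positive_zero (majorant l0 \<alpha> \<nu> \<eta>) vs
             \<and> 0 < vs \<and> vs \<le> ((1 - \<nu>) / l0) powr (1 / \<alpha>)))
     \<and> (l0 * \<eta> powr \<alpha> \<le> (1 - \<nu>) powr (\<alpha> + 1) * (\<alpha> / (1 + \<alpha>)) powr \<alpha> \<longrightarrow>
          (\<exists>vs vss. minimal_positive_zero (majorant l0 \<alpha> \<nu> \<eta>) vs
             \<and> maximal_positive_zero (majorant l0 \<alpha> \<nu> \<eta>) vss
             \<and> vs \<le> vss \<and> (\<eta> = \<eta>max \<longrightarrow> vss = vs)
             \<and> (R \<ge> vs \<longrightarrow>
                  (\<forall>k. newton_like_iter B F x0 k \<in> D)
                  \<and> (\<exists>xs\<in>D. newton_like_iter B F x0 \<longlonglongrightarrow> xs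
                       \<and> blinfun_apply B (F xs) = 0
                       \<and> (\<eta> < \<eta>max \<longrightarrow>
                            unique_zero_in (\<lambda>x. blinfun_apply B (F x)) (ball x0 vss \<inter> cball x0 R) xs)
                       \<and> (\<eta> = \<eta>max \<longrightarrow>
                            unique_zero_in (\<lambda>x. blinfun_apply B (F x)) (cball x0 vss \<inter> cball x0 R) xs)))))"
proof -
  let ?g = "majorant l0 \<alpha> \<nu> \<eta>" and ?ec = "critical_eta l0 \<alpha> \<nu>"
  let ?P = "l0 * \<eta> powr \<alpha> \<le> (1 - \<nu>) powr (\<alpha> + 1) * (\<alpha> / (1 + \<alpha>)) powr \<alpha>"
  let ?T = "\<lambda>x. x - blinfun_apply B (F x)"
  note par = assms(8,10,13)
  have P_iff: "?P \<longleftrightarrow> \<eta> \<le> ?ec"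
    using eta_condition_iff[OF par assms(11)] .
  have etamax: "\<eta>max = ?ec"
    using eta_equation_imp_critical[OF par assms(17,18)] .
  have necessary: ?P if "v > 0" "?g v = 0" for v
    using majorant_ge[OF par, of v \<eta>] that P_iff by simp
  show ?thesis
  proof (cases ?P)
    case False
    then show ?thesis using necessary by blast
  next
    case True
    then obtain vs vss where v: "0 < vs" "vs \<le> turning_point l0 \<alpha> \<nu>" "vs \<le> vss"
      and zeros: "\<And>u. u \<ge> 0 \<Longrightarrow> ?g u = 0 \<longleftrightarrow> u = vs \<or> u = vss"
      and nonpos: "\<And>u. vs \<le> u \<Longrightarrow> u \<le> vss \<Longrightarrow> ?g u \<le> 0"
      and double: "vs = vss \<longleftrightarrow> \<eta> = ?ec"
      using majorant_zeros[OF par assms(11)] P_iff by blast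
    have min: "minimal_positive_zero ?g vs" and max: "maximal_positive_zero ?g vss"
      using v zeros by (auto simp: minimal_positive_zero_def maximal_positive_zero_def)
    have convergence: "(\<forall>k. newton_like_iter B F x0 k \<in> D)
        \<and> (\<exists>xs\<in>D. newton_like_iter B F x0 \<longlonglongrightarrow> xs
             \<and> blinfun_apply B (F xs) = 0
             \<and> (\<eta> < \<eta>max \<longrightarrow>
                  unique_zero_in (\<lambda>x. blinfun_apply B (F x)) (ball x0 vss \<inter> cball x0 R) xs)
             \<and> (\<eta> = \<eta>max \<longrightarrow>
                  unique_zero_in (\<lambda>x. blinfun_apply B (F x)) (cball x0 vss \<inter> cball x0 R) xs))"
      if R: "vs \<le> R"
    proof -
      define h where "h = (\<lambda>t. t + ?g t)"
      interpret majorized_iteration ?T h x0 R vs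
      proof
        show "norm (?T x0 - x0) \<le> h 0"
          using assms(16) by (simp add: h_def majorant_0)
        show "norm (?T y - ?T x) \<le> h t - h s"
          if "0 \<le> s" "s \<le> t" "t \<le> R" "norm (x - x0) \<le> s" "norm (y - x) \<le> t - s" for s t x y
          unfolding h_def
          by (rule newton_like_map_majorized[OF _ par(1) _ assms(14,15) that])
            (use assms(2,7,10) in auto)
        show "continuous_on {0..R} h"
          unfolding h_def
          by (intro continuous_intros continuous_on_subset[OF continuous_on_majorant[OF par(1)]]) auto
        show "u = vs" if "0 \<le> u" "u \<le> vs" "h u = u" for u
          using that zeros[of u] v by (auto simp: h_def)
      qed (use v R zeros[of vs] in \<open>auto simp: h_def\<close>)
      have sub: "cball x0 vs \<subseteq> D"
        using R assms(7) by force
      obtain z where z: "(\<lambda>k. (?T ^^ k) x0) \<longlonglongrightarrow> z" "z \<in> cball x0 vs" "?T z = z"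
        using iterate_tendsto_fixpoint by blast
      have unique: "y = z" if y: "blinfun_apply B (F y) = 0" "y \<in> cball x0 R"
        and near: "dist x0 y < vss \<or> (vs = vss \<and> dist x0 y \<le> vss)" for y
      proof -
        \<comment> \<open>The comparison from above must start at or beyond \<open>vs\<close>, even if \<open>y\<close> is closer to \<open>x0\<close>.\<close>
        define r where "r = max vs (dist x0 y)"
        have r: "vs \<le> r" "r \<le> R" "r \<le> vss" "r < vss \<or> r = vs" "y \<in> cball x0 r"
          using near v R y(2) by (auto simp: r_def)
        have "(\<lambda>k. (?T ^^ k) x0) \<longlonglongrightarrow> y"
        proof (rule fixpoint_is_limit[OF r(1,2)])
          show "h r \<le> r"
            using nonpos[OF r(1,3)] by (simp add: h_def)
          show "u = vs" if "vs \<le> u" "u \<le> r" "h u = u" for u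
            using that zeros[of u] v r(4) by (auto simp: h_def)
        qed (use y r in auto)
        then show ?thesis
          using z(1) LIMSEQ_unique by blast
      qed
      have zero: "blinfun_apply B (F z) = 0"
        using z(3) by simp
      have iter: "newton_like_iter B F x0 = (\<lambda>k. (?T ^^ k) x0)"
        using newton_like_iter_eq_funpow by blast
      have unique_in: "unique_zero_in (\<lambda>x. blinfun_apply B (F x)) S z"
        if "z \<in> S"
          "\<And>y. y \<in> S \<Longrightarrow> y \<in> cball x0 R \<and> (dist x0 y < vss \<or> (vs = vss \<and> dist x0 y \<le> vss))"
        for S
        unfolding unique_zero_in_def using that zero unique by blast
      have "unique_zero_in (\<lambda>x. blinfun_apply B (F x)) (ball x0 vss \<inter> cball x0 R) z"
        if "\<eta> < \<eta>max"
      proof (rule unique_in)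
        have "vs < vss"
          using that v(3) double etamax by linarith
        then show "z \<in> ball x0 vss \<inter> cball x0 R"
          using z(2) R by simp
      qed simp
      moreover have "unique_zero_in (\<lambda>x. blinfun_apply B (F x)) (cball x0 vss \<inter> cball x0 R) z"
        if "\<eta> = \<eta>max"
      proof (rule unique_in)
        have eq: "vs = vss"
          using that double etamax by simp
        show "z \<in> cball x0 vss \<inter> cball x0 R"
          using z(2) R eq by simp
        show "y \<in> cball x0 R \<and> (dist x0 y < vss \<or> (vs = vss \<and> dist x0 y \<le> vss))"
          if "y \<in> cball x0 vss \<inter> cball x0 R" for y
          using that eq by simp
      qed
      moreover have "newton_like_iter B F x0 k \<in> D" for k
        unfolding iter using sub iterate_in_cball by blast
      moreover have "newton_like_iter B F x0 \<longlonglongrightarrow> z"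
        unfolding iter by (rule z(1))
      moreover have "z \<in> D"
        using z(2) sub by blast
      ultimately show ?thesis
        using zero by blast
    qed
    have "vs \<le> ((1 - \<nu>) / l0) powr (1 / \<alpha>)" and "\<exists>v>0. ?g v = 0"
      using v zeros[of vs] by (auto simp: turning_point_def)
    moreover have "\<eta> = \<eta>max \<longrightarrow> vss = vs"
      using double etamax by blast
    ultimately show ?thesis
      using True v min max convergence by blast
  qed
qed

end
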